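(* Let $d\ge2$ and $l\ge3$ be integers, and assume $$0<\beta\le\frac1{dl-d-l+2}=\frac1{(d-1)(l-1)+1}\qquad\text{and}\qquad\Phi_{d,l}(\beta)>0.$$ Then $$\sup_{(\rho,\theta)\in\mathcal R_\beta}\Psi_{d,l}(\beta,\rho,\theta)=2\Phi_{d,l}(\beta),$$ and $(\beta^2,\,l(d-1)\beta^2)$ is the unique maximizer in $\mathcal R_\beta$.
   Context: For integers $d,l\ge2$ and $0<\beta<1/d$: $$\Phi_{d,l}(\beta)=-\beta\log\beta+(l-1)(1-\beta)\log(1-\beta)-\tfrac ld(1-d\beta)\log(1-d\beta),$$ $$\mathcal R_\beta:=\left\{(\rho,\theta):0<\rho<\beta,\ \max\left\{0,2l\beta-l\rho-\tfrac ld\right\}<\theta<l\beta-l\rho\right\},$$ and for $(\rho,\theta)\in\mathcal R_\beta$, $$\begin{aligned}\Psi_{d,l}(\beta,\rho,\theta)={}&-\rho\log\rho-\theta\log\tfrac\theta l+(l-1)(1-2\beta+\rho)\log(1-2\beta+\rho)+\theta\log(d-1)\\&+2(l-1)(\beta-\rho)\log(\beta-\rho)-2l\left(\beta-\rho-\tfrac\theta l\right)\log\left(\beta-\rho-\tfrac\theta l\right)\\&-\tfrac ld\left(1-2\beta d+\rho d+\tfrac{\theta d}l\right)\log\left(1-2\beta d+\rho d+\tfrac{\theta d}l\right).\end{aligned}$$ *)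

theory Defs
  imports Complex_Main
begin

definition Phi :: "nat \<Rightarrow> nat \<Rightarrow> real \<Rightarrow> real" where
  "Phi d l \<beta> =
     - \<beta> * ln \<beta> + (real l - 1) * (1 - \<beta>) * ln (1 - \<beta>)
     - real l / real d * (1 - real d * \<beta>) * ln (1 - real d * \<beta>)"

definition R_region :: "nat \<Rightarrow> nat \<Rightarrow> real \<Rightarrow> (real \<times> real) set" where
  "R_region d l \<beta> =
     {(\<rho>, \<theta>). 0 < \<rho> \<and> \<rho> < \<beta> \<and>
        max 0 (2 * real l * \<beta> - real l * \<rho> - real l / real d) < \<theta> \<and>
        \<theta> < real l * \<beta> - real l * \<rho>}"

(* If 0 < beta < 1/d, every argument of ln below is positive on R_region d l beta. *)
definition Psi :: "nat \<Rightarrow> nat \<Rightarrow> real \<Rightarrow> real \<Rightarrow> real \<Rightarrow> real" where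
  "Psi d l \<beta> \<rho> \<theta> =
     - \<rho> * ln \<rho> - \<theta> * ln (\<theta> / real l)
     + (real l - 1) * (1 - 2 * \<beta> + \<rho>) * ln (1 - 2 * \<beta> + \<rho>)
     + \<theta> * ln (real d - 1)
     + 2 * (real l - 1) * (\<beta> - \<rho>) * ln (\<beta> - \<rho>)
     - 2 * real l * (\<beta> - \<rho> - \<theta> / real l) * ln (\<beta> - \<rho> - \<theta> / real l)
     - real l / real d * (1 - 2 * \<beta> * real d + \<rho> * real d + \<theta> * real d / real l)
         * ln (1 - 2 * \<beta> * real d + \<rho> * real d + \<theta> * real d / real l)"

end

theory Submission
  imports Defs
begin

text \<open>
  Put \<open>a = \<beta> - \<rho>\<close> and \<open>x = \<theta>/l\<close>. For fixed \<open>\<rho>\<close> the function \<open>\<Psi>\<close> is strictly concave in \<open>x\<close>,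
  with critical point given by \<open>x u = (d - 1) (a - x)\<^sup>2\<close>, where
  \<open>u = 1 - 2 d \<beta> + d \<rho> + d x\<close>. Writing \<open>x = s a\<close>, these
  points form the rational curve \<open>a = (1 - d \<beta>) s / ((1 - s) (d - 1 + s))\<close>, \<open>0 < s < 1\<close>. Along it
  the \<open>\<rho>\<close>-derivative of \<open>\<Psi>\<close> is
  \<open>(l-1) ln (1-\<beta>-a) - ln (\<beta>-a) - (l-2) ln a + l ln (s/(d-1))\<close>. Up to the positive factor
  \<open>a'/a\<close> its derivative in \<open>s\<close> is
  \<open>2 + a/(\<beta>-a) - (l-1) a/(1-\<beta>-a) - l s (d-2+2s)/(d-1+s\<^sup>2)\<close>. The bound on \<open>\<beta>\<close> gives
  \<open>(l-1) (\<beta>-a) \<le> 1-\<beta>-a\<close>, and together with \<open>a < \<beta>\<close> it gives \<open>s < 2/l\<close>, so this is positive.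
  Hence \<open>\<Psi>\<close> has along the curve a single critical point, a maximum, at \<open>s = (d-1) \<beta> / (1-\<beta>)\<close>.
\<close>

section \<open>Convexity and derivative of t ln t\<close>

text \<open>The left side is the tangent line of t ln t at \<open>q\<close>, evaluated at
  \<open>p\<close>. The inequality is ln t \<le> t - 1 at t = \<open>q / p\<close>, multiplied by
  \<open>p\<close>.\<close>

lemma xlnx_tangent_le:
  fixes p q :: real
  assumes "0 < p" "0 < q"
  shows "p * ln q + p - q \<le> p * ln p"
proof -
  have "ln (q / p) \<le> q / p - 1" using assms by (intro ln_le_minus_one) simp
  then have "p * (ln q - ln p) \<le> p * (q / p - 1)"
    using assms by (intro mult_left_mono) (simp_all add: ln_div)
  then show ?thesis using assms by (simp add: algebra_simps)
qed

lemma xlnx_tangent_less: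
  fixes p q :: real
  assumes "0 < p" "0 < q" "p \<noteq> q"
  shows "p * ln q + p - q < p * ln p"
proof -
  have "ln (q / p) \<noteq> q / p - 1" using ln_eq_minus_one[of "q / p"] assms by auto
  moreover have "ln (q / p) \<le> q / p - 1" using assms by (intro ln_le_minus_one) simp
  ultimately have "p * (ln q - ln p) < p * (q / p - 1)"
    using assms by (intro mult_strict_left_mono) (simp_all add: ln_div)
  then show ?thesis using assms by (simp add: algebra_simps)
qed

lemma has_real_derivative_xlnx:
  fixes w :: "real \<Rightarrow> real"
  assumes "(w has_real_derivative w') (at s)" "0 < w s"
  shows "((\<lambda>s. w s * ln (w s)) has_real_derivative w' * (ln (w s) + 1)) (at s)"
  using assms by (auto intro!: derivative_eq_intros simp: field_simps)

lemma ln_crit: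
  fixes x y u e :: real
  assumes "x * u = e * y\<^sup>2" "0 < x" "0 < y" "0 < u" "0 < e"
  shows "ln x + ln u = ln e + 2 * ln y"
proof -
  have "ln x + ln u = ln (x * u)" using assms(2-) by (simp add: ln_mult)
  also have "\<dots> = ln e + ln (y\<^sup>2)" unfolding assms(1) using assms(2-) by (simp add: ln_mult)
  finally show ?thesis using assms by (simp add: ln_realpow)
qed

section \<open>Parameters and coordinates on the region\<close>

locale small_density =
  fixes d l :: nat and \<beta> :: real
  assumes d: "2 \<le> d" and l: "3 \<le> l" and \<beta>_pos: "0 < \<beta>"
    and \<beta>_le: "\<beta> \<le> 1 / (real d * real l - real d - real l + 2)"
begin

text \<open>With x = \<theta>/l, \<open>y\<close> and \<open>u\<close> are the logarithm arguments
  in \<open>Psi\<close> that depend on both variables.\<close>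

definition y :: "real \<Rightarrow> real \<Rightarrow> real" where "y \<rho> x = \<beta> - \<rho> - x"
definition u :: "real \<Rightarrow> real \<Rightarrow> real" where
  "u \<rho> x = 1 - 2 * \<beta> * real d + \<rho> * real d + x * real d"

text \<open>Grouping the terms as w * ln w lets the tangent inequalities and
  \<open>has_real_derivative_xlnx\<close> apply termwise.\<close>

lemma Psi_eq:
  "Psi d l \<beta> \<rho> (real l * x) =
     - (\<rho> * ln \<rho>) - real l * (x * ln x)
     + (real l - 1) * ((1 - 2 * \<beta> + \<rho>) * ln (1 - 2 * \<beta> + \<rho>))
     + real l * x * ln (real d - 1)
     + 2 * (real l - 1) * ((\<beta> - \<rho>) * ln (\<beta> - \<rho>))
     - 2 * real l * (y \<rho> x * ln (y \<rho> x))
     - real l / real d * (u \<rho> x * ln (u \<rho> x))"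
  using l by (simp add: Psi_def y_def u_def)

text \<open>Scaling \<open>u\<close> by l/d and \<open>y\<close> by l turns the bounds on \<theta>
  into positivity of these logarithm arguments.\<close>

lemma R_region_iff:
  "(\<rho>, real l * x) \<in> R_region d l \<beta> \<longleftrightarrow>
     0 < \<rho> \<and> \<rho> < \<beta> \<and> 0 < x \<and> 0 < y \<rho> x \<and> 0 < u \<rho> x"
proof -
  have "2 * real l * \<beta> - real l * \<rho> - real l / real d < real l * x \<longleftrightarrow>
        (real l / real d) * 0 < (real l / real d) * u \<rho> x"
    using d by (simp add: u_def field_simps)
  also have "\<dots> \<longleftrightarrow> 0 < u \<rho> x"
    using d l by (subst mult_less_cancel_left_pos) auto
  finally have 1: "2 * real l * \<beta> - real l * \<rho> - real l / real d < real l * x \<longleftrightarrow> 0 < u \<rho> x" .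
  have "real l * x < real l * \<beta> - real l * \<rho> \<longleftrightarrow> real l * x < real l * (\<beta> - \<rho>)"
    by (simp add: algebra_simps)
  also have "\<dots> \<longleftrightarrow> 0 < y \<rho> x"
    using l by (subst mult_less_cancel_left_pos) (auto simp: y_def)
  finally have 2: "real l * x < real l * \<beta> - real l * \<rho> \<longleftrightarrow> 0 < y \<rho> x" .
  show ?thesis using l by (auto simp: R_region_def 1 2 zero_less_mult_iff)
qed

section \<open>Strict concavity in x and the chain rule for \<open>Psi\<close>\<close>

text \<open>Each convex term exceeds its tangent at \<open>z\<close> by a nonnegative amount
  (\<open>X\<close>, \<open>Y\<close>, \<open>U\<close>), and the remaining first-order term
  vanishes by \<open>crit\<close>. Strictness comes from \<open>X\<close> alone.\<close>

lemma Psi_fibre_less: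
  assumes "0 < x" "0 < y \<rho> x" "0 < u \<rho> x" "0 < z" "0 < y \<rho> z" "0 < u \<rho> z"
    and crit: "z * u \<rho> z = (real d - 1) * (y \<rho> z)\<^sup>2" and "x \<noteq> z"
  shows "Psi d l \<beta> \<rho> (real l * x) < Psi d l \<beta> \<rho> (real l * z)"
proof -
  have ln: "ln z + ln (u \<rho> z) = ln (real d - 1) + 2 * ln (y \<rho> z)"
    using assms d by (intro ln_crit) auto
  define X Y U where "X = x * ln x - (x * ln z + x - z)"
    and "Y = y \<rho> x * ln (y \<rho> x) - (y \<rho> x * ln (y \<rho> z) + y \<rho> x - y \<rho> z)"
    and "U = u \<rho> x * ln (u \<rho> x) - (u \<rho> x * ln (u \<rho> z) + u \<rho> x - u \<rho> z)"
  have "0 < X" "0 \<le> Y" "0 \<le> U"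
    using xlnx_tangent_less[of x z] xlnx_tangent_le[of "y \<rho> x" "y \<rho> z"]
      xlnx_tangent_le[of "u \<rho> x" "u \<rho> z"] assms by (auto simp: X_def Y_def U_def)
  then have "0 < real l * X + 2 * real l * Y + real l / real d * U"
    using l d by (intro add_pos_nonneg) auto
  also have "\<dots> = Psi d l \<beta> \<rho> (real l * z) - Psi d l \<beta> \<rho> (real l * x)
      + real l * (x - z) * (ln (real d - 1) + 2 * ln (y \<rho> z) - ln z - ln (u \<rho> z))"
  proof -
    have y: "y \<rho> x = y \<rho> z + z - x" by (simp add: y_def)
    have u: "u \<rho> x = u \<rho> z + real d * (x - z)" by (simp add: u_def algebra_simps)
    \<comment> \<open>With the logarithms frozen as atoms and l written as c d, the claim is a
      polynomial identity.\<close>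
    define c lx lz ly ly' lu lu' where "c = real l / real d" and "lx = ln x" and "lz = ln z"
      and "ly = ln (y \<rho> x)" and "ly' = ln (y \<rho> z)" and "lu = ln (u \<rho> x)" and "lu' = ln (u \<rho> z)"
    have c: "real l = c * real d" using d by (simp add: c_def)
    show ?thesis
      unfolding Psi_eq X_def Y_def U_def c_def[symmetric] lx_def[symmetric] lz_def[symmetric]
        ly_def[symmetric] ly'_def[symmetric] lu_def[symmetric] lu'_def[symmetric]
      unfolding y u c by (simp only: algebra_simps)
  qed
  finally have "0 < Psi d l \<beta> \<rho> (real l * z) - Psi d l \<beta> \<rho> (real l * x)
      + real l * (x - z) * (ln (real d - 1) + 2 * ln (y \<rho> z) - ln z - ln (u \<rho> z))" .
  moreover have "ln (real d - 1) + 2 * ln (y \<rho> z) - ln z - ln (u \<rho> z) = 0" using ln by linarith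
  ultimately show ?thesis by (simp only: mult_zero_right)
qed

text \<open>The constants 1 from (w ln w)' = w' (ln w + 1) cancel. The two brackets are kept apart
  because the second one vanishes on the critical curve.\<close>

lemma Psi_has_derivative:
  assumes r: "(r has_real_derivative r') (at s)" and x: "(x has_real_derivative x') (at s)"
    and "0 < r s" "r s < \<beta>" "0 < 1 - 2 * \<beta> + r s"
      "0 < x s" "0 < y (r s) (x s)" "0 < u (r s) (x s)"
  shows "((\<lambda>s. Psi d l \<beta> (r s) (real l * x s)) has_real_derivative
     r' * ((real l - 1) * ln (1 - 2 * \<beta> + r s) - ln (r s) - 2 * (real l - 1) * ln (\<beta> - r s)
           + 2 * real l * ln (y (r s) (x s)) - real l * ln (u (r s) (x s)))
     + real l * x' * (ln (real d - 1) + 2 * ln (y (r s) (x s)) - ln (x s) - ln (u (r s) (x s)))) (at s)"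
proof -
  have y: "((\<lambda>s. y (r s) (x s)) has_real_derivative - r' - x') (at s)"
    unfolding y_def by (rule derivative_eq_intros r x refl | simp)+
  have u: "((\<lambda>s. u (r s) (x s)) has_real_derivative real d * (r' + x')) (at s)"
    unfolding u_def by (rule derivative_eq_intros r x refl | simp add: algebra_simps)+
  have v: "((\<lambda>s. 1 - 2 * \<beta> + r s) has_real_derivative r') (at s)"
    by (rule derivative_eq_intros r x refl | simp)+
  have a: "((\<lambda>s. \<beta> - r s) has_real_derivative - r') (at s)"
    by (rule derivative_eq_intros r x refl | simp)+
  note D = has_real_derivative_xlnx[OF r] has_real_derivative_xlnx[OF x]
    has_real_derivative_xlnx[OF y] has_real_derivative_xlnx[OF u]
    has_real_derivative_xlnx[OF v] has_real_derivative_xlnx[OF a]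
  have "0 < \<beta> - r s" using assms by simp
  show ?thesis unfolding Psi_eq
    apply (rule DERIV_cong)
     apply (rule DERIV_add DERIV_diff DERIV_minus DERIV_cmult DERIV_cmult_right D x assms \<open>0 < \<beta> - r s\<close>)+
    using d by (simp add: algebra_simps)
qed

section \<open>Bounds on \<beta> and the critical curve\<close>

abbreviation "\<kappa> \<equiv> 1 - real d * \<beta>"

definition A :: "real \<Rightarrow> real" where
  "A s = \<kappa> * s / ((1 - s) * (real d - 1 + s))"

text \<open>The factored denominator is the usable form: \<open>\<kappa>_ge\<close> is a
  rearrangement of it, and \<open>l\<beta>_le\<close> follows by d - 1 \<ge> 1.\<close>

lemma \<beta>_bound: "\<beta> * ((real d - 1) * (real l - 1) + 1) \<le> 1"
proof -
  have "real d * real l - real d - real l + 2 = (real d - 1) * (real l - 1) + 1"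
    by (simp add: algebra_simps)
  moreover have "0 < (real d - 1) * (real l - 1) + 1" using d l by (simp add: add_nonneg_pos)
  ultimately show ?thesis using \<beta>_le by (simp add: field_simps)
qed

lemma l\<beta>_le: "real l * \<beta> \<le> 1"
proof -
  have "1 * (real l - 1) \<le> (real d - 1) * (real l - 1)"
    using d l by (intro mult_right_mono) auto
  then have "\<beta> * real l \<le> \<beta> * ((real d - 1) * (real l - 1) + 1)"
    using \<beta>_pos by (intro mult_left_mono) auto
  then show ?thesis using \<beta>_bound by (simp add: mult.commute)
qed

lemma \<kappa>_ge: "(real d - 1) * (real l - 2) * \<beta> \<le> \<kappa>"
  using \<beta>_bound by (simp add: algebra_simps)

lemma \<kappa>_pos: "0 < \<kappa>"
proof -
  have "0 < (real d - 1) * (real l - 2) * \<beta>" using d l \<beta>_pos by simp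
  then show ?thesis using \<kappa>_ge by linarith
qed

lemma \<beta>_le_third: "3 * \<beta> \<le> 1"
proof -
  have "3 * \<beta> \<le> real l * \<beta>" using l \<beta>_pos by (intro mult_right_mono) auto
  then show ?thesis using l\<beta>_le by simp
qed

lemma A_mult: "0 < s \<Longrightarrow> s < 1 \<Longrightarrow> A s * ((1 - s) * (real d - 1 + s)) = \<kappa> * s"
  using d by (simp add: A_def)

lemma A_pos: "0 < s \<Longrightarrow> s < 1 \<Longrightarrow> 0 < A s"
  using d \<kappa>_pos by (simp add: A_def)

text \<open>The factor after \<open>A s\<close> is the logarithmic derivative 1/s + 1/(1 - s) - 1/(d
  - 1 + s).\<close>

lemma A_has_derivative:
  assumes "0 < s" "s < 1"
  shows "(A has_real_derivative
    A s * ((real d - 1 + s\<^sup>2) / (s * ((1 - s) * (real d - 1 + s))))) (at s)"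
proof -
  have "(1 - s) * (real d - 1 + s) \<noteq> 0" using assms d by auto
  then show ?thesis unfolding A_def [abs_def]
    apply (intro derivative_eq_intros refl)
    using assms by (auto simp: divide_simps) (simp add: algebra_simps power2_eq_square)
qed

lemma A_strict_mono:
  assumes "0 < s" "s < t" "t < 1"
  shows "A s < A t"
proof (rule DERIV_pos_imp_increasing[OF \<open>s < t\<close>])
  fix z assume z: "s \<le> z" "z \<le> t"
  with assms have "0 < z" "z < 1" by auto
  then have "0 < A z * ((real d - 1 + z\<^sup>2) / (z * ((1 - z) * (real d - 1 + z))))"
    using A_pos[of z] d by (intro mult_pos_pos divide_pos_pos) (auto intro: add_pos_pos)
  with A_has_derivative[OF \<open>0 < z\<close> \<open>z < 1\<close>]
  show "\<exists>D. (A has_real_derivative D) (at z) \<and> 0 < D" by blast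
qed

text \<open>\<open>A\<close> has a pole at 1, so the intermediate value theorem is applied to the
  equation with denominators cleared, a quadratic that changes sign on [0, 1].\<close>

lemma A_surj:
  assumes "0 < a"
  obtains s where "0 < s" "s < 1" "A s = a"
proof -
  define f where "f s = \<kappa> * s - a * ((1 - s) * (real d - 1 + s))" for s
  have "f 0 < 0" "0 < f 1" using assms \<kappa>_pos d by (simp_all add: f_def)
  moreover have "continuous_on {0..1} f" unfolding f_def by (intro continuous_intros)
  ultimately obtain s where s: "0 \<le> s" "s \<le> 1" "f s = 0"
    using IVT'[of f 0 0 1] by force
  with \<open>f 0 < 0\<close> \<open>0 < f 1\<close> have "0 < s" "s < 1" by (metis less_eq_real_def less_irrefl)+
  moreover have "A s = a"
  proof -
    have "\<kappa> * s = a * ((1 - s) * (real d - 1 + s))" using s(3) by (simp add: f_def)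
    moreover have "(1 - s) * (real d - 1 + s) \<noteq> 0" using \<open>0 < s\<close> \<open>s < 1\<close> d by auto
    ultimately show ?thesis unfolding A_def by simp
  qed
  ultimately show ?thesis by (rule that)
qed

text \<open>Here u = \<open>\<kappa> - d * (1 - s) * A s\<close>, so by d s + (d - 1)(1 - s) = d - 1
  + s the claim is the equation defining \<open>A s\<close>.\<close>

lemma curve_u:
  assumes "0 < s" "s < 1"
  shows "u (\<beta> - A s) (s * A s) * s = (real d - 1) * (1 - s)\<^sup>2 * A s"
proof -
  have "u (\<beta> - A s) (s * A s) * s - (real d - 1) * (1 - s)\<^sup>2 * A s
      = \<kappa> * s - A s * ((1 - s) * (real d - 1 + s))"
    by (simp add: u_def algebra_simps power2_eq_square)
  then show ?thesis using A_mult[OF assms] by simp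
qed

lemma curve_y: "y (\<beta> - A s) (s * A s) = (1 - s) * A s"
  by (simp add: y_def algebra_simps)

lemma curve_pos:
  assumes "0 < s" "s < 1"
  shows "0 < s * A s" "0 < y (\<beta> - A s) (s * A s)" "0 < u (\<beta> - A s) (s * A s)"
proof -
  show "0 < s * A s" "0 < y (\<beta> - A s) (s * A s)" using A_pos assms by (auto simp: curve_y)
  have "0 < (real d - 1) * (1 - s)\<^sup>2 * A s" using A_pos[OF assms] assms d by simp
  then show "0 < u (\<beta> - A s) (s * A s)"
    using curve_u[OF assms] assms by (metis zero_less_mult_pos2)
qed

lemma curve_crit:
  assumes "0 < s" "s < 1"
  shows "(s * A s) * u (\<beta> - A s) (s * A s) = (real d - 1) * (y (\<beta> - A s) (s * A s))\<^sup>2"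
proof -
  have "(s * A s) * u (\<beta> - A s) (s * A s) = A s * (u (\<beta> - A s) (s * A s) * s)" by simp
  then show ?thesis unfolding curve_u[OF assms] curve_y by (simp add: power2_eq_square)
qed

section \<open>Derivative of \<open>Psi\<close> along the curve and its monotone factor\<close>

definition g :: "real \<Rightarrow> real" where
  "g s = Psi d l \<beta> (\<beta> - A s) (real l * (s * A s))"

definition f :: "real \<Rightarrow> real" where
  "f s = (real l - 1) * ln (1 - \<beta> - A s) - ln (\<beta> - A s) - (real l - 2) * ln (A s)
         + real l * (ln s - ln (real d - 1))"

text \<open>The x-derivative of \<open>Psi\<close> vanishes on the curve, so only the
  \<rho>-derivative \<open>f\<close> survives; the minus sign comes from \<rho> =
  \<open>\<beta> - A s\<close>.\<close>

lemma g_has_derivative: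
  assumes s: "0 < s" "s < 1" and "A s < \<beta>"
  shows "(g has_real_derivative
    - (A s * ((real d - 1 + s\<^sup>2) / (s * ((1 - s) * (real d - 1 + s))))) * f s) (at s)"
proof -
  note A = A_has_derivative[OF s] and c = curve_pos[OF s]
  define A' where "A' = A s * ((real d - 1 + s\<^sup>2) / (s * ((1 - s) * (real d - 1 + s))))"
  have dA: "(A has_real_derivative A') (at s)" using A by (simp add: A'_def)
  have dr: "((\<lambda>s. \<beta> - A s) has_real_derivative - A') (at s)"
    by (rule derivative_eq_intros dA refl | simp)+
  have dx: "((\<lambda>s. s * A s) has_real_derivative A s + s * A') (at s)"
    by (rule derivative_eq_intros dA refl | simp)+
  have lnc: "ln (s * A s) + ln (u (\<beta> - A s) (s * A s)) = ln (real d - 1) + 2 * ln (y (\<beta> - A s) (s * A s))"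
    using c d curve_crit[OF s] by (intro ln_crit) auto
  have lnx: "ln (s * A s) = ln s + ln (A s)" using s A_pos[OF s] by (simp add: ln_mult)
  have v: "1 - 2 * \<beta> + (\<beta> - A s) = 1 - \<beta> - A s" by simp
  have vpos: "0 < 1 - 2 * \<beta> + (\<beta> - A s)" using assms \<beta>_le_third \<beta>_pos by linarith
  have f: "(real l - 1) * ln (1 - 2 * \<beta> + (\<beta> - A s)) - ln (\<beta> - A s)
      - 2 * (real l - 1) * ln (\<beta> - (\<beta> - A s)) + 2 * real l * ln (y (\<beta> - A s) (s * A s))
      - real l * ln (u (\<beta> - A s) (s * A s)) = f s"
  proof -
    \<comment> \<open>The critical equation trades \<open>y\<close> and \<open>u\<close> for x =
      \<open>s * A s\<close>, which leaves only logarithms of s, \<open>A s\<close> and d -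
      1.\<close>
    have "2 * real l * ln (y (\<beta> - A s) (s * A s)) - real l * ln (u (\<beta> - A s) (s * A s))
        = real l * (2 * ln (y (\<beta> - A s) (s * A s)) - ln (u (\<beta> - A s) (s * A s)))"
      by (simp add: algebra_simps)
    also have "\<dots> = real l * (ln s + ln (A s) - ln (real d - 1))"
      using lnc lnx by (intro arg_cong2[where f = "(*)"]) auto
    finally show ?thesis unfolding f_def v by (simp add: algebra_simps)
  qed
  have crit: "ln (real d - 1) + 2 * ln (y (\<beta> - A s) (s * A s)) - ln (s * A s)
      - ln (u (\<beta> - A s) (s * A s)) = 0"
    using lnc by linarith
  have "0 < \<beta> - A s" "\<beta> - A s < \<beta>" using assms A_pos[OF s] by auto
  from Psi_has_derivative[OF dr dx this vpos c, unfolded f crit]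
  show ?thesis by (simp add: A'_def g_def [abs_def])
qed

text \<open>If l s \<ge> 2, the curve equation with \<open>\<kappa>_ge\<close> and A s < \<beta>
  gives (d - 1)(l - 2) s < (1 - s)(d - 1 + s), while l s \<ge> 2 gives the reverse
  inequality.\<close>

lemma s_less:
  assumes s: "0 < s" "s < 1" and "A s < \<beta>"
  shows "real l * s < 2"
proof (rule ccontr)
  assume "\<not> ?thesis"
  then have ls: "2 \<le> real l * s" by simp
  have e: "1 \<le> real d - 1" and l': "3 \<le> real l" using d l by auto
  have "(real d - 1) * (real l - 2) * \<beta> * s \<le> \<kappa> * s"
    using \<kappa>_ge s by (intro mult_right_mono) auto
  also have "\<dots> < \<beta> * ((1 - s) * (real d - 1 + s))"
    unfolding A_mult[OF s, symmetric] using assms d by (intro mult_strict_right_mono) auto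
  finally have "\<beta> * ((real d - 1) * (real l - 2) * s) < \<beta> * ((1 - s) * (real d - 1 + s))"
    by (simp add: algebra_simps)
  then have *: "(real d - 1) * (real l - 2) * s < (1 - s) * (real d - 1 + s)"
    using \<beta>_pos by simp
  \<comment> \<open>Adding (d - 1)(1 - s) to both sides yields (1 - s)(d - 1 + s) \<le> (d - 1)(l -
    2) s.\<close>
  have "s * (1 - s) \<le> (real d - 1) * (real l * s - s - 1)"
  proof -
    have "s * (1 - s) \<le> 1 - s" using s by (simp add: mult_left_le_one_le)
    also have "\<dots> \<le> 1 * (real l * s - s - 1)" using ls by simp
    also have "\<dots> \<le> (real d - 1) * (real l * s - s - 1)"
      using e ls s by (intro mult_right_mono) auto
    finally show ?thesis .
  qed
  with * show False by (simp add: algebra_simps)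
qed

text \<open>The summands are compared separately: the first is below 2 because l s < 2, the second
  is at most \<open>A s / (\<beta> - A s)\<close> because l \<beta> \<le> 1.\<close>

lemma f_derivative_factor_pos:
  assumes s: "0 < s" "s < 1" and "A s < \<beta>"
  shows "real l * (s * (real d - 2 + 2 * s) / (real d - 1 + s\<^sup>2)) + (real l - 1) * (A s / (1 - \<beta> - A s))
    < 2 + A s / (\<beta> - A s)"
proof (rule add_less_le_mono)
  have e: "1 \<le> real d - 1" and l': "3 \<le> real l" using d l by auto
  have pos: "0 < real d - 1 + s\<^sup>2" using e by (simp add: add_pos_nonneg)
  have ls: "real l * s < 2" by (rule s_less[OF assms])
  have "(real l * s) * (real d - 2) \<le> 2 * (real d - 2)"
    using ls e by (intro mult_right_mono) auto
  \<comment> \<open>This follows from l s < 2 and 4 (l - 1) < \<open>l\<^sup>2\<close>, which is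
    \<open>(l - 2)\<^sup>2 > 0\<close>.\<close>
  moreover have "(real l - 1) * s\<^sup>2 < 1"
  proof -
    have "(real l)\<^sup>2 * ((real l - 1) * s\<^sup>2) = (real l - 1) * (real l * s)\<^sup>2"
      by (simp add: power_mult_distrib)
    also have "\<dots> \<le> (real l - 1) * 2\<^sup>2"
      using ls l' s by (intro mult_left_mono power_mono) auto
    also have "\<dots> < (real l)\<^sup>2"
    proof -
      have "0 < (real l - 2)\<^sup>2" using l' by simp
      then show ?thesis by (simp add: power2_eq_square algebra_simps)
    qed
    finally have "(real l)\<^sup>2 * ((real l - 1) * s\<^sup>2) < (real l)\<^sup>2 * 1" by simp
    then show ?thesis using l' by (subst (asm) mult_less_cancel_left_pos) auto
  qed
  ultimately have "real l * (s * (real d - 2 + 2 * s)) < 2 * (real d - 1 + s\<^sup>2)"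
    by (simp add: algebra_simps power2_eq_square)
  then show "real l * (s * (real d - 2 + 2 * s) / (real d - 1 + s\<^sup>2)) < 2"
    using pos by (simp add: field_simps)
  have "0 < 1 - \<beta> - A s" using assms \<beta>_le_third \<beta>_pos by linarith
  \<comment> \<open>The right side minus the left is (1 - l \<beta>) + (l - 2) A s.\<close>
  moreover have "(real l - 1) * (\<beta> - A s) \<le> 1 - \<beta> - A s"
  proof -
    have "0 \<le> (real l - 2) * A s" using l' A_pos[OF s] by simp
    then show ?thesis using l\<beta>_le by (simp add: algebra_simps)
  qed
  ultimately have "(real l - 1) / (1 - \<beta> - A s) \<le> 1 / (\<beta> - A s)"
    using assms by (simp add: field_simps)
  then have "A s * ((real l - 1) / (1 - \<beta> - A s)) \<le> A s * (1 / (\<beta> - A s))"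
    using A_pos[OF s] by (intro mult_left_mono) auto
  then show "(real l - 1) * (A s / (1 - \<beta> - A s)) \<le> A s / (\<beta> - A s)" by (simp add: mult.commute)
qed

text \<open>With \<open>c\<close> = A'/A, all terms of the derivative except l/s carry the factor
  \<open>c\<close>. Writing 1/s as a multiple of \<open>c\<close> too leaves the difference bounded
  in \<open>f_derivative_factor_pos\<close>.\<close>

lemma f_has_pos_derivative:
  assumes s: "0 < s" "s < 1" and "A s < \<beta>"
  shows "\<exists>D. (f has_real_derivative D) (at s) \<and> 0 < D"
proof -
  define c where "c = (real d - 1 + s\<^sup>2) / (s * ((1 - s) * (real d - 1 + s)))"
  have e: "1 \<le> real d - 1" using d by auto
  have dA: "(A has_real_derivative A s * c) (at s)"
    using A_has_derivative[OF s] by (simp add: c_def)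
  have pos: "0 < 1 - \<beta> - A s" "0 < \<beta> - A s" "0 < A s"
    using assms \<beta>_le_third \<beta>_pos A_pos[OF s] by auto
  have ne: "real d - 1 + s\<^sup>2 \<noteq> 0" "real d - 1 + s \<noteq> 0"
    using e s by (simp_all add: add_pos_nonneg less_imp_neq[symmetric])
  have cpos: "0 < c" unfolding c_def using s e by (intro divide_pos_pos mult_pos_pos) (auto intro: add_pos_pos)
  have inv: "1 / s = c * (1 - s * (real d - 2 + 2 * s) / (real d - 1 + s\<^sup>2))"
    using s ne unfolding c_def by (simp add: divide_simps) (simp add: algebra_simps power2_eq_square)
  have "(f has_real_derivative
      c * (A s / (\<beta> - A s)) - c * ((real l - 1) * (A s / (1 - \<beta> - A s)))
      - (real l - 2) * c + real l * (1 / s)) (at s)"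
    unfolding f_def [abs_def]
    by (rule derivative_eq_intros dA refl | use pos s in \<open>simp add: field_simps\<close>)+
  moreover have "c * (A s / (\<beta> - A s)) - c * ((real l - 1) * (A s / (1 - \<beta> - A s)))
      - (real l - 2) * c + real l * (1 / s)
    = c * (2 + A s / (\<beta> - A s) - (real l * (s * (real d - 2 + 2 * s) / (real d - 1 + s\<^sup>2))
        + (real l - 1) * (A s / (1 - \<beta> - A s))))"
    unfolding inv by (simp only: ring_distribs) (simp add: algebra_simps)
  moreover have "0 < \<dots>" using f_derivative_factor_pos[OF assms] cpos by simp
  ultimately show ?thesis by metis
qed

section \<open>The critical parameter and the value at the maximizer\<close>

text \<open>This is the ratio x / (\<beta> - \<rho>) at \<rho> = \<open>\<beta>\<^sup>2\<close>, x =
  \<open>(d - 1) * \<beta>\<^sup>2\<close>.\<close>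

definition s0 :: real where "s0 = (real d - 1) * \<beta> / (1 - \<beta>)"

lemma s0: "0 < s0" "s0 < 1"
  using \<beta>_le_third \<beta>_pos d \<kappa>_pos by (auto simp: s0_def field_simps)

lemma one_minus_s0: "1 - s0 = \<kappa> / (1 - \<beta>)"
  using \<beta>_le_third by (simp add: s0_def field_simps)

lemma A_s0: "A s0 = \<beta> * (1 - \<beta>)"
proof -
  have "real d - 1 + s0 = (real d - 1) / (1 - \<beta>)"
    using \<beta>_le_third by (simp add: s0_def field_simps)
  then show ?thesis unfolding A_def one_minus_s0
    using \<kappa>_pos \<beta>_le_third d by (simp add: s0_def divide_simps power2_eq_square)
qed

lemma A_s0_less: "A s0 < \<beta>"
  using \<beta>_pos by (simp add: A_s0 field_simps)

text \<open>At \<open>s0\<close> every logarithm argument is a monomial in \<beta>, 1 - \<beta> and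
  d - 1, and the coefficients of their logarithms cancel.\<close>

lemma f_s0: "f s0 = 0"
proof -
  have "1 - \<beta> - A s0 = (1 - \<beta>)\<^sup>2" "\<beta> - A s0 = \<beta>\<^sup>2"
    by (simp_all add: A_s0 power2_eq_square algebra_simps)
  then have "ln (1 - \<beta> - A s0) = 2 * ln (1 - \<beta>)" "ln (\<beta> - A s0) = 2 * ln \<beta>"
    using \<beta>_pos \<beta>_le_third by (simp_all add: ln_realpow)
  moreover have "ln (A s0) = ln \<beta> + ln (1 - \<beta>)"
    unfolding A_s0 using \<beta>_pos \<beta>_le_third by (simp add: ln_mult)
  moreover have "ln s0 = ln (real d - 1) + ln \<beta> - ln (1 - \<beta>)"
    unfolding s0_def using \<beta>_pos \<beta>_le_third d by (simp add: ln_mult ln_div)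
  ultimately show ?thesis unfolding f_def by (simp only:) (simp add: algebra_simps)
qed

text \<open>\<open>f\<close> is increasing with zero \<open>s0\<close> and g' = - h f with h > 0, so
  the mean value theorem gives growth of \<open>g\<close> before \<open>s0\<close> and decay after
  it.\<close>

lemma g_less:
  assumes s: "0 < s" "s < 1" and As: "A s < \<beta>" and "s \<noteq> s0"
  shows "g s < g s0"
proof -
  \<comment> \<open>Monotonicity of \<open>A\<close> keeps the segment between \<open>s\<close> and
    \<open>s0\<close> in the range A < \<beta> that the derivative lemmas require.\<close>
  have A_less: "A z < \<beta>" if "z \<le> t" "A t < \<beta>" "0 < z" "t < 1" for z t
    using A_strict_mono[of z t] that by (cases "z = t") auto
  define h where "h z = A z * ((real d - 1 + z\<^sup>2) / (z * ((1 - z) * (real d - 1 + z))))" for z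
  have h: "0 < h z" if "0 < z" "z < 1" for z
    unfolding h_def using that A_pos[OF that] d
    by (intro mult_pos_pos divide_pos_pos) (auto intro: add_pos_pos)
  have dg: "(g has_real_derivative - h z * f z) (at z)" if "0 < z" "z < 1" "A z < \<beta>" for z
    using g_has_derivative[OF that] by (simp add: h_def)
  have f_less: "f z < f t" if "0 < z" "z < t" "t < 1" "A t < \<beta>" for z t
    by (rule DERIV_pos_imp_increasing[OF \<open>z < t\<close>])
       (use that A_less in \<open>auto intro!: f_has_pos_derivative\<close>)
  consider "s < s0" | "s0 < s" using \<open>s \<noteq> s0\<close> by linarith
  then show ?thesis
  proof cases
    case 1
    obtain z where z: "s < z" "z < s0" "g s0 - g s = (s0 - s) * (- h z * f z)"
      using MVT2[OF 1, of g "\<lambda>z. - h z * f z"] dg s s0 A_s0_less A_less by (metis less_le_trans le_less_trans)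
    have "f z < 0" using f_less[of z s0] z s s0 A_s0_less f_s0 by auto
    moreover have "0 < h z" using h[of z] z s s0 by auto
    ultimately have "0 < - h z * f z" by (intro mult_neg_neg) simp_all
    then have "0 < (s0 - s) * (- h z * f z)" using 1 by (intro mult_pos_pos[of "s0 - s"]) simp_all
    with z show ?thesis by linarith
  next
    case 2
    obtain z where z: "s0 < z" "z < s" "g s - g s0 = (s - s0) * (- h z * f z)"
      using MVT2[OF 2, of g "\<lambda>z. - h z * f z"] dg s s0 As A_less by (metis less_le_trans le_less_trans)
    have "A z < \<beta>" using z s s0 As by (intro A_less[of z s]) auto
    then have "0 < f z" using f_less[of s0 z] z s s0 f_s0 by auto
    then have "0 < h z * f z" using h[of z] z s s0 by simp
    then have "0 < (s - s0) * (h z * f z)" using 2 by (intro mult_pos_pos[of "s - s0"]) simp_all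
    with z show ?thesis by linarith
  qed
qed

text \<open>The second entry is bracketed as l times x to match \<open>Psi_eq\<close> and
  \<open>R_region_iff\<close>.\<close>

abbreviation "p0 \<equiv> (\<beta>\<^sup>2, real l * ((real d - 1) * \<beta>\<^sup>2))"

lemma curve_s0: "\<beta> - A s0 = \<beta>\<^sup>2" "s0 * A s0 = (real d - 1) * \<beta>\<^sup>2"
proof -
  show "\<beta> - A s0 = \<beta>\<^sup>2" by (simp add: A_s0 power2_eq_square right_diff_distrib)
  show "s0 * A s0 = (real d - 1) * \<beta>\<^sup>2"
    unfolding A_s0 unfolding s0_def using \<beta>_le_third by (simp add: power2_eq_square)
qed

lemma p0_in: "p0 \<in> R_region d l \<beta>"
  unfolding R_region_iff
  using curve_pos[OF s0] A_pos[OF s0] A_s0_less \<beta>_pos \<beta>_le_third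
  by (simp add: curve_s0 power2_eq_square)

text \<open>All logarithm arguments factor into \<beta>, 1 - \<beta>, \<open>\<kappa>\<close> and d
  - 1. The ln (d - 1) terms cancel, and a polynomial identity in the other three logarithms
  remains.\<close>

lemma Psi_p0: "Psi d l \<beta> (\<beta>\<^sup>2) (real l * ((real d - 1) * \<beta>\<^sup>2)) = 2 * Phi d l \<beta>"
proof -
  have a: "\<beta> - \<beta>\<^sup>2 = \<beta> * (1 - \<beta>)" and v: "1 - 2 * \<beta> + \<beta>\<^sup>2 = (1 - \<beta>)\<^sup>2"
    and y: "y (\<beta>\<^sup>2) ((real d - 1) * \<beta>\<^sup>2) = \<beta> * \<kappa>"
    and u: "u (\<beta>\<^sup>2) ((real d - 1) * \<beta>\<^sup>2) = \<kappa>\<^sup>2"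
    by (simp_all add: y_def u_def power2_eq_square algebra_simps)
  have L: "ln (\<beta>\<^sup>2) = 2 * ln \<beta>" "ln ((1 - \<beta>)\<^sup>2) = 2 * ln (1 - \<beta>)" "ln (\<kappa>\<^sup>2) = 2 * ln \<kappa>"
    "ln (\<beta> * (1 - \<beta>)) = ln \<beta> + ln (1 - \<beta>)" "ln (\<beta> * \<kappa>) = ln \<beta> + ln \<kappa>"
    "ln ((real d - 1) * \<beta>\<^sup>2) = ln (real d - 1) + 2 * ln \<beta>"
    using \<beta>_pos \<beta>_le_third \<kappa>_pos d by (simp_all add: ln_mult ln_realpow)
  define B C K E where "B = ln \<beta>" and "C = ln (1 - \<beta>)" and "K = ln \<kappa>" and "E = ln (real d - 1)"
  show ?thesis
    unfolding Psi_eq a v y u L Phi_def B_def[symmetric] C_def[symmetric] K_def[symmetric] E_def[symmetric]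
    using d by (simp add: divide_simps) (simp add: algebra_simps power2_eq_square)
qed

text \<open>A point is first moved at fixed \<rho> onto the curve, then along the curve to
  \<open>s0\<close>. Away from \<open>p0\<close> at least one of the two moves strictly increases
  \<open>Psi\<close>.\<close>

lemma Psi_less:
  assumes "(\<rho>, \<theta>) \<in> R_region d l \<beta>" "(\<rho>, \<theta>) \<noteq> p0"
  shows "Psi d l \<beta> \<rho> \<theta> < 2 * Phi d l \<beta>"
proof -
  define x where "x = \<theta> / real l"
  have \<theta>: "\<theta> = real l * x" using l by (simp add: x_def)
  have R: "0 < \<rho>" "\<rho> < \<beta>" "0 < x" "0 < y \<rho> x" "0 < u \<rho> x"
    using assms(1) unfolding \<theta> R_region_iff by auto
  obtain s where s: "0 < s" "s < 1" and As: "A s = \<beta> - \<rho>"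
    using A_surj[of "\<beta> - \<rho>"] R by auto
  have \<rho>: "\<rho> = \<beta> - A s" using As by simp
  have less: "Psi d l \<beta> \<rho> \<theta> < g s" if "x \<noteq> s * A s"
    unfolding g_def \<theta> \<rho>
    using R curve_pos[OF s] curve_crit[OF s] that by (intro Psi_fibre_less) (auto simp: \<rho>)
  have g0: "g s0 = 2 * Phi d l \<beta>"
    by (simp only: g_def curve_s0 Psi_p0)
  show ?thesis
  proof (cases "s = s0")
    case True
    then have "x \<noteq> s * A s" using assms(2) curve_s0 \<theta> \<rho> by auto
    with less True g0 show ?thesis by simp
  next
    case False
    then have "g s < 2 * Phi d l \<beta>" using g_less[OF s] R \<rho> g0 by auto
    moreover have "Psi d l \<beta> \<rho> \<theta> \<le> g s"
      using less by (cases "x = s * A s") (auto simp: g_def \<theta> \<rho>)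
    ultimately show ?thesis by simp
  qed
qed

end

section \<open>Supremum and uniqueness of the maximizer\<close>

theorem lemma3p13:
  fixes d l :: nat and \<beta> :: real
  assumes "2 \<le> d" and "3 \<le> l"
    and "0 < \<beta>"
    and "\<beta> \<le> 1 / (real d * real l - real d - real l + 2)"
    and "Phi d l \<beta> > 0"
  shows "(SUP (\<rho>, \<theta>) \<in> R_region d l \<beta>. Psi d l \<beta> \<rho> \<theta>) = 2 * Phi d l \<beta>
    \<and> (\<forall>p. is_arg_max (\<lambda>(\<rho>, \<theta>). Psi d l \<beta> \<rho> \<theta>) (\<lambda>q. q \<in> R_region d l \<beta>) p
            \<longleftrightarrow> p = (\<beta>\<^sup>2, real l * (real d - 1) * \<beta>\<^sup>2))"
proof -
  interpret small_density d l \<beta> using assms by unfold_locales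
  let ?F = "\<lambda>(\<rho>, \<theta>). Psi d l \<beta> \<rho> \<theta>"
  have p0: "(\<beta>\<^sup>2, real l * (real d - 1) * \<beta>\<^sup>2) = p0" by simp
  have F0: "?F p0 = 2 * Phi d l \<beta>" using Psi_p0 by simp
  have less: "?F q < ?F p0" if "q \<in> R_region d l \<beta>" "q \<noteq> p0" for q
    using Psi_less[of "fst q" "snd q"] that unfolding F0 by (cases q) auto
  have "(SUP q \<in> R_region d l \<beta>. ?F q) = ?F p0"
  proof (rule cSup_eq_maximum)
    show "?F p0 \<in> ?F ` R_region d l \<beta>" using p0_in by (rule imageI)
    show "v \<le> ?F p0" if "v \<in> ?F ` R_region d l \<beta>" for v
    proof -
      obtain q where "q \<in> R_region d l \<beta>" "v = ?F q" using \<open>v \<in> _\<close> by (rule imageE)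
      then show ?thesis using less[of q] by (metis order_refl less_imp_le)
    qed
  qed
  moreover have "is_arg_max ?F (\<lambda>q. q \<in> R_region d l \<beta>) p \<longleftrightarrow> p = p0" for p
    unfolding is_arg_max_def using p0_in less by (metis less_asym less_irrefl)
  ultimately show ?thesis unfolding p0 F0 by blast
qed

end
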